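(* Let the channel be in any one of the three cases described in the context, and let $\sigma^2$ vary with all other parameters fixed. When $\sigma^2$ increases, the following claims are true for each case: (1) $\mathcal{E}^\star$ strictly increases. (2) $s^\star$ strictly decreases. Moreover, $\lim_{\sigma^2\to+\infty}s^\star=0$ and $\lim_{\sigma^2\to0}s^\star=s_2$, where $s_2$ satisfies $\kappa\, g(Bs_2)=P_c$.
   Context: Constants: bandwidth $B$ (Hz), noise variance $\sigma^2$, power-amplifier efficiency $\xi$, rate-independent circuit power $P_c>0$, coefficient $\kappa\ge 0$. The function $\phi(R)$, $R\ge0$, satisfies $\phi(0)=0$ and is differentiable, strictly increasing and (not necessarily strictly) convex of $R\ge0$. The function $\rho(s)$, $s\ge 0$ (minimum transmission power needed to achieve spectral efficiency $s$, divided by $\sigma^2$) is defined in three cases, where $G$ denotes the channel power gain. Case 1 (static channel, transmitter knows the channel): $G$ is a constant and $\rho(s)=\min\{p\ge0:\log_2(1+Gp)\ge s\}=\frac1G(2^s-1)$. Case 2 (fast-varying channel, transmitter knows its distribution): $G\ge0$ is a random variable with a probability density function and $\rho(s)=\min\{p\ge 0:\mathbb{E}_G[\log_2(1+Gp)]\ge s\}$. Case 3 (fast-varying channel, transmitter knows the channel): $G$ is a random variable as in Case 2 and $\rho(s)=\min \mathbb{E}_G[p(G)]$ over all nonnegative functions $p(\cdot)$ of $G\ge0$ satisfying $\mathbb{E}_G[\log_2(1+Gp(G))]\ge s$. Minimum total power: $P(s)=\kappa\phi(Bs)+\frac{\sigma^2}{\xi}\rho(s)+P_c$. Energy per bit (the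 energy efficiency; smaller is better): $\mathcal{E}(s)=\frac{P(s)}{Bs}$, which is $+\infty$ at $s=0$. The optimum value is $\mathcal{E}^\star=\min_{s\ge0}\mathcal{E}(s)$ and $s^\star=\arg\min_{s\ge0}\mathcal{E}(s)$ is the (unique) minimizer; both are regarded as functions of the parameters. Finally $g(R)=R\phi'(R)-\phi(R)$, where a prime denotes the derivative.
   Formalization: The limit s₂ as σ²→0 is asserted only if κg(Bs)=P_c has a solution s≥0 (it has none e.g. for κ=0 or affine φ); otherwise s*→+∞ is proved. In Cases 2 and 3, E[log₂(1+G)]<∞ is assumed, without which the minima defining ρ do not exist. *)

theory Defs
  imports "HOL-Probability.Probability"
begin

text \<open>
  The minimum transmission power \<open>\<rho>(s)\<close>, normalised by the noise variance, for the three channel models.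
  Each minimum is taken literally (\<open>LEAST\<close>): the value is attained and is a lower bound.
\<close>

definition rho_static :: "real \<Rightarrow> real \<Rightarrow> real" where
  "rho_static G s = (LEAST p. 0 \<le> p \<and> log 2 (1 + G * p) \<ge> s)"

definition rho_dist_known :: "'a measure \<Rightarrow> ('a \<Rightarrow> real) \<Rightarrow> real \<Rightarrow> real" where
  "rho_dist_known M G s = (LEAST p. 0 \<le> p \<and> (\<integral>\<omega>. log 2 (1 + G \<omega> * p) \<partial>M) \<ge> s)"

text \<open>
  When the transmitter tracks the channel it chooses a power allocation \<open>p\<close> as a function of the
  gain. Allocations of infinite mean power are excluded explicitly, because the
  Bochner integral would assign them the value 0. For \<open>G\<close> as in \<open>fading_gain\<close> below,
  integrability of \<open>p(G)\<close> implies integrability of the rate, as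
  \<open>log (1 + g p) \<le> log (1 + g) + log (1 + p)\<close>.
\<close>

definition power_allocation :: "'a measure \<Rightarrow> ('a \<Rightarrow> real) \<Rightarrow> (real \<Rightarrow> real) \<Rightarrow> bool" where
  "power_allocation M G p \<longleftrightarrow>
     p \<in> borel_measurable borel \<and> (\<forall>g\<ge>0. 0 \<le> p g) \<and> integrable M (\<lambda>\<omega>. p (G \<omega>))"

definition rho_channel_known :: "'a measure \<Rightarrow> ('a \<Rightarrow> real) \<Rightarrow> real \<Rightarrow> real" where
  "rho_channel_known M G s =
     (LEAST q. \<exists>p. power_allocation M G p \<and>
        (\<integral>\<omega>. log 2 (1 + G \<omega> * p (G \<omega>)) \<partial>M) \<ge> s \<and> q = (\<integral>\<omega>. p (G \<omega>) \<partial>M))"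

text \<open>
  A nonnegative random gain with a probability density function. The last conjunct says that
  expected rates are finite (for unit power, hence for every power); otherwise every positive
  rate could be supported by arbitrarily small positive power and the minima above would not exist.
\<close>

definition fading_gain :: "'a measure \<Rightarrow> ('a \<Rightarrow> real) \<Rightarrow> bool" where
  "fading_gain M G \<longleftrightarrow>
     prob_space M \<and> (\<exists>f. distributed M lborel G f) \<and> (AE \<omega> in M. 0 \<le> G \<omega>) \<and>
     integrable M (\<lambda>\<omega>. log 2 (1 + G \<omega>))"

definition channel_power :: "'a measure \<Rightarrow> (real \<Rightarrow> real) \<Rightarrow> bool" where
  "channel_power M \<rho> \<longleftrightarrow>
     (\<exists>G>0. \<rho> = rho_static G) \<or>
     (\<exists>G. fading_gain M G \<and> \<rho> = rho_dist_known M G) \<or>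
     (\<exists>G. fading_gain M G \<and> \<rho> = rho_channel_known M G)"

text \<open>In the following, \<open>v\<close> is the noise variance \<open>\<sigma>\<^sup>2\<close>.\<close>

definition total_power ::
    "real \<Rightarrow> real \<Rightarrow> real \<Rightarrow> real \<Rightarrow> (real \<Rightarrow> real) \<Rightarrow> (real \<Rightarrow> real) \<Rightarrow> real \<Rightarrow> real \<Rightarrow> real" where
  "total_power B \<xi> Pc \<kappa> \<phi> \<rho> v s = \<kappa> * \<phi> (B * s) + v / \<xi> * \<rho> s + Pc"

definition energy_per_bit ::
    "real \<Rightarrow> real \<Rightarrow> real \<Rightarrow> real \<Rightarrow> (real \<Rightarrow> real) \<Rightarrow> (real \<Rightarrow> real) \<Rightarrow> real \<Rightarrow> real \<Rightarrow> ereal" where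
  "energy_per_bit B \<xi> Pc \<kappa> \<phi> \<rho> v s =
     (if s = 0 then \<infinity> else ereal (total_power B \<xi> Pc \<kappa> \<phi> \<rho> v s / (B * s)))"

definition opt_energy ::
    "real \<Rightarrow> real \<Rightarrow> real \<Rightarrow> real \<Rightarrow> (real \<Rightarrow> real) \<Rightarrow> (real \<Rightarrow> real) \<Rightarrow> real \<Rightarrow> ereal" where
  "opt_energy B \<xi> Pc \<kappa> \<phi> \<rho> v = (LEAST e. e \<in> energy_per_bit B \<xi> Pc \<kappa> \<phi> \<rho> v ` {0..})"

definition opt_rate ::
    "real \<Rightarrow> real \<Rightarrow> real \<Rightarrow> real \<Rightarrow> (real \<Rightarrow> real) \<Rightarrow> (real \<Rightarrow> real) \<Rightarrow> real \<Rightarrow> real" where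
  "opt_rate B \<xi> Pc \<kappa> \<phi> \<rho> v =
     (THE s. is_arg_min (energy_per_bit B \<xi> Pc \<kappa> \<phi> \<rho> v) (\<lambda>s. 0 \<le> s) s)"

text \<open>
  \<open>deriv\<close> is the two-sided derivative, while \<open>\<phi>\<close> is only constrained on \<open>[0, \<infinity>)\<close>; this is harmless
  since at \<open>R = 0\<close> the derivative is multiplied by 0.
\<close>

definition g_fun :: "(real \<Rightarrow> real) \<Rightarrow> real \<Rightarrow> real" where
  "g_fun \<phi> R = R * deriv \<phi> R - \<phi> R"

end

theory Submission
  imports Defs
begin

text \<open>
  Write \<open>c = v / \<xi>\<close> and \<open>\<Phi> s = \<kappa> * \<phi> (B * s)\<close>. The energy per bit is stationary at \<open>s\<close> exactly when
  \<open>(s * \<Phi>' s - \<Phi> s) + c * (s * \<rho>' s - \<rho> s) = Pc\<close>. By convexity of \<open>\<phi>\<close> the first summand is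
  nondecreasing; if \<open>\<rho>'\<close> is continuous, strictly increasing and unbounded, then the second one is
  positive, strictly increasing and unbounded in \<open>s\<close>. So there is exactly one stationary point, it is the
  minimiser, and comparing the equation for different \<open>v\<close> gives the monotonicity and both limits.

  The required properties of \<open>\<rho>\<close> are obtained from a family of supporting lines. For a channel known
  in distribution these are the reciprocals of the tangents of the concave expected rate; for a channel
  known to the transmitter they come from the multiplier inequality of the water-filling allocation
  \<open>p g = max 0 (\<mu> - 1 / g)\<close>, where \<open>\<rho>' = \<mu> * ln 2\<close>.
\<close>

section \<open>Optimal rate of a convex power curve\<close>

text \<open>The quotient \<open>\<psi> s / s\<close> exceeds its value at \<open>a\<close> near 0,
  because \<open>\<psi>\<close> stays above \<open>c > 0\<close>, and it is increasing at
  \<open>a\<close>. Its minimum over a compact interval ending at \<open>a\<close> is therefore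
  interior, and the derivative of the quotient vanishes there. Minimising takes the place of an
  intermediate value argument, so \<open>\<psi>'\<close> may be discontinuous.\<close>

lemma stationary_ratio_exists:
  fixes \<psi> \<psi>' :: "real \<Rightarrow> real"
  assumes deriv: "\<And>s. s > 0 \<Longrightarrow> (\<psi> has_real_derivative \<psi>' s) (at s)"
    and "c > 0" and lower: "\<And>s. s > 0 \<Longrightarrow> c \<le> \<psi> s"
    and "a > 0" and increasing: "\<psi> a < a * \<psi>' a"
  obtains s where "0 < s" "s < a" "s * \<psi>' s = \<psi> s"
proof -
  define k where "k s = \<psi> s / s" for s
  have dk: "(k has_real_derivative (\<psi>' s * s - \<psi> s) / (s * s)) (at s)" if "s > 0" for s
    unfolding k_def using that by (auto intro!: derivative_eq_intros deriv)
  have k_a: "k a > 0"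
    using lower[of a] \<open>a > 0\<close> \<open>c > 0\<close> by (auto simp: k_def)
  \<comment> \<open>The bound \<open>e \<le> c / (2 * k a)\<close> gives
    \<open>k e \<ge> c / e \<ge> 2 * k a > k a\<close>, which excludes the left endpoint;
    \<open>a / 2\<close> keeps \<open>e\<close> below \<open>a\<close>.\<close>
  define e where "e = min (a / 2) (c / (2 * k a))"
  have e: "0 < e" "e < a" "e \<le> c / (2 * k a)"
    using \<open>a > 0\<close> \<open>c > 0\<close> k_a by (auto simp: e_def min_def)
  have "e * k a * 2 \<le> c" using e k_a by (simp add: field_simps)
  then have "k a < c / e"
    using mult_pos_pos[OF e(1) k_a] e by (simp add: pos_less_divide_eq mult.commute)
  also have "c / e \<le> k e"
    using lower[of e] e by (auto simp: k_def divide_right_mono)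
  finally have k_e: "k a < k e" .
  have "continuous_on {e..a} k"
    using e by (intro continuous_at_imp_continuous_on ballI DERIV_isCont[OF dk]) auto
  then obtain x where x: "x \<in> {e..a}" and min: "\<And>y. y \<in> {e..a} \<Longrightarrow> k x \<le> k y"
    using continuous_attains_inf[of "{e..a}" k] e by auto
  have "x \<noteq> e" using min[of a] k_e e by auto
  moreover have "x \<noteq> a"
  proof
    assume "x = a"
    have "(\<psi>' a * a - \<psi> a) / (a * a) > 0"
      using increasing \<open>a > 0\<close> by (simp add: mult.commute)
    then obtain d where d: "d > 0" "\<And>h. h > 0 \<Longrightarrow> h < d \<Longrightarrow> k (a - h) < k a"
      using DERIV_pos_inc_left[OF dk[OF \<open>a > 0\<close>]] by auto
    \<comment> \<open>Small enough for the local decrease of \<open>k\<close>, and at most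
      \<open>a - e\<close> so that \<open>a - h\<close> stays in the interval.\<close>
    define h where "h = min (d / 2) (a - e)"
    have "k (a - h) < k a" using d e by (intro d(2)) (auto simp: h_def)
    moreover have "k a \<le> k (a - h)"
      using min[of "a - h"] e d \<open>x = a\<close> by (auto simp: h_def)
    ultimately show False by simp
  qed
  ultimately have x: "e < x" "x < a" using x by auto
  define d where "d = min (x - e) (a - x)"
  have "(\<psi>' x * x - \<psi> x) / (x * x) = 0"
  proof (rule DERIV_local_min[OF dk])
    show "\<forall>y. \<bar>x - y\<bar> < d \<longrightarrow> k x \<le> k y"
      by (intro allI impI min) (auto simp: d_def abs_less_iff)
  qed (use x e in \<open>auto simp: d_def\<close>)
  then have "x * \<psi>' x = \<psi> x" using x e by (simp add: mult.commute)
  with x e show thesis by (intro that[of x]) auto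
qed

text \<open>Strict convexity is encoded by supporting lines with slope \<open>m\<close>, the form in
  which the channel models deliver it. That \<open>m\<close> is the derivative of
  \<open>\<rho>\<close> is derived from this. The lines also bound \<open>\<rho>\<close> at
  \<open>t = 0\<close>, which yields the sign of \<open>m\<close> and of the intercepts.\<close>

locale power_curve =
  fixes \<rho> m :: "real \<Rightarrow> real"
  assumes zero: "\<rho> 0 = 0"
    and nonneg: "s \<ge> 0 \<Longrightarrow> \<rho> s \<ge> 0"
    and tangent: "s > 0 \<Longrightarrow> t \<ge> 0 \<Longrightarrow> \<rho> s + m s * (t - s) \<le> \<rho> t"
    and cont_slope: "continuous_on {0<..} m"
    and strict_mono_slope: "strict_mono_on {0<..} m"
    and slope_unbounded: "\<exists>s>0. m s > K"
begin

lemma slope_less: "0 < s \<Longrightarrow> s < t \<Longrightarrow> m s < m t"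
  using strict_mono_slope by (auto simp: strict_mono_on_def)

text \<open>The supporting line at \<open>s / 2\<close>, evaluated at 0, gives a nonnegative slope
  there; strict monotonicity makes the slope at \<open>s\<close> positive.\<close>

lemma slope_pos:
  assumes "s > 0" shows "m s > 0"
proof -
  have "m (s / 2) * (s / 2) \<ge> 0"
    using tangent[of "s / 2" 0] nonneg[of "s / 2"] zero assms by auto
  then have "m (s / 2) \<ge> 0" using assms by (simp add: zero_le_mult_iff)
  with slope_less[of "s / 2" s] assms show ?thesis by simp
qed

lemma pos:
  assumes "s > 0" shows "\<rho> s > 0"
proof -
  have "0 < m (s / 2) * (s - s / 2)"
    using slope_pos[of "s / 2"] assms by simp
  also have "\<dots> \<le> \<rho> s"
    using tangent[of "s / 2" s] nonneg[of "s / 2"] assms by auto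
  finally show ?thesis .
qed

text \<open>Two supporting lines are chained through the midpoint \<open>u\<close>: the line at
  \<open>s\<close> bounds \<open>\<rho> u\<close>, the line at \<open>u\<close> bounds
  \<open>\<rho> t\<close>, and the slopes at \<open>s\<close> and \<open>u\<close> differ strictly
  in the favourable direction.\<close>

lemma strict_tangent:
  assumes "s > 0" "t > 0" "t \<noteq> s"
  shows "\<rho> s + m s * (t - s) < \<rho> t"
proof -
  define u where "u = (s + t) / 2"
  have u: "u > 0" using assms by (simp add: u_def)
  have eq: "u - s = (t - s) / 2" "t - u = (t - s) / 2" by (auto simp: u_def field_simps)
  have "m s * (t - u) < m u * (t - u)"
  proof (cases "s < t")
    case True
    then show ?thesis using assms eq slope_less[of s u] by (auto simp: u_def)
  next
    case False
    then show ?thesis using assms eq slope_less[of u s] by (auto simp: u_def)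
  qed
  moreover have "m s * (t - s) = m s * (t - u) + m s * (u - s)"
    by (simp add: algebra_simps)
  ultimately show ?thesis
    using tangent[of u t] tangent[of s u] assms u by linarith
qed

text \<open>The supporting lines at \<open>s\<close> and at \<open>t\<close> squeeze the difference
  quotient between \<open>m s\<close> and \<open>m t\<close>, and \<open>m\<close> is
  continuous.\<close>

lemma has_derivative_slope:
  assumes "s > 0" shows "(\<rho> has_real_derivative m s) (at s)"
proof -
  have m: "m \<midarrow>s\<rightarrow> m s"
    using cont_slope assms
    by (simp add: continuous_on_eq_continuous_at isCont_def)
  have "eventually (\<lambda>t. t > 0) (at s)"
    using assms order_tendstoD(1)[OF tendsto_ident_at] by blast
  then have bounds: "\<forall>\<^sub>F t in at s. min (m s) (m t) \<le> (\<rho> t - \<rho> s) / (t - s) \<and>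
      (\<rho> t - \<rho> s) / (t - s) \<le> max (m s) (m t)"
  proof (rule eventually_mono[OF eventually_conj[OF _ eventually_neq_at_within[of s]]], safe)
    fix t assume t: "t > 0" "t \<noteq> s"
    have a: "m s * (t - s) \<le> \<rho> t - \<rho> s" "\<rho> t - \<rho> s \<le> m t * (t - s)"
      using tangent[of s t] tangent[of t s] assms t by (auto simp: algebra_simps)
    have "m s \<le> (\<rho> t - \<rho> s) / (t - s) \<and> (\<rho> t - \<rho> s) / (t - s) \<le> m t" if "t > s"
      using a that by (simp add: pos_le_divide_eq pos_divide_le_eq)
    moreover have "m t \<le> (\<rho> t - \<rho> s) / (t - s) \<and> (\<rho> t - \<rho> s) / (t - s) \<le> m s" if "t < s"
      using a that by (simp add: neg_le_divide_eq neg_divide_le_eq)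
    ultimately show "min (m s) (m t) \<le> (\<rho> t - \<rho> s) / (t - s)" "(\<rho> t - \<rho> s) / (t - s) \<le> max (m s) (m t)"
      using t(2) by (meson linorder_neqE_linordered_idom min.coboundedI1 min.coboundedI2 max.coboundedI1 max.coboundedI2)+
  qed
  have "((\<lambda>t. (\<rho> t - \<rho> s) / (t - s)) \<longlongrightarrow> m s) (at s)"
  proof (rule tendsto_sandwich)
    show "((\<lambda>t. min (m s) (m t)) \<longlongrightarrow> m s) (at s)"
      using tendsto_min[OF tendsto_const m, of "m s"] by simp
    show "((\<lambda>t. max (m s) (m t)) \<longlongrightarrow> m s) (at s)"
      using tendsto_max[OF tendsto_const m, of "m s"] by simp
  qed (use bounds in \<open>auto elim: eventually_mono\<close>)
  then show ?thesis by (simp add: has_field_derivative_iff)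
qed

text \<open>This is the function \<open>g\<close> of the paper, formed with \<open>\<rho>\<close> in place of \<open>\<phi>\<close>.\<close>

definition gap :: "real \<Rightarrow> real" where
  "gap s = s * m s - \<rho> s"

text \<open>\<open>- gap t\<close> is the intercept at 0 of the supporting line at \<open>t\<close>.
  Since that line lies below \<open>\<rho>\<close> at \<open>s\<close>,
  \<open>s * m t - \<rho> s \<le> gap t\<close>, and \<open>m s < m t\<close>.\<close>

lemma gap_less:
  assumes "0 < s" "s < t" shows "gap s < gap t"
proof -
  have "s * m s < s * m t" using assms slope_less by simp
  moreover have "m t * (s - t) = s * m t - t * m t" by (simp add: algebra_simps)
  moreover have "\<rho> t + m t * (s - t) \<le> \<rho> s" using tangent[of t s] assms by simp
  ultimately show ?thesis unfolding gap_def by linarith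
qed

lemma gap_pos:
  assumes "s > 0" shows "gap s > 0"
proof -
  have "gap (s / 2) \<ge> 0"
    using tangent[of "s / 2" 0] assms zero by (simp add: gap_def algebra_simps)
  with gap_less[of "s / 2" s] assms show ?thesis by simp
qed

text \<open>The supporting line at \<open>s\<close>, evaluated at 1, gives
  \<open>gap s \<ge> m s - \<rho> 1\<close>.\<close>

lemma gap_unbounded: "\<exists>s>0. gap s > K"
proof -
  obtain s where "s > 0" "m s > K + \<rho> 1" using slope_unbounded by blast
  then show ?thesis
    using tangent[of s 1] by (intro exI[of _ s]) (auto simp: gap_def algebra_simps)
qed

end

section \<open>Balance equation, the minimiser and its dependence on the noise\<close>

locale energy_tradeoff = power_curve +
  fixes B \<xi> Pc \<kappa> :: real and \<phi> :: "real \<Rightarrow> real"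
  assumes B_pos: "B > 0" and \<xi>_pos: "\<xi> > 0" and Pc_pos: "Pc > 0" and \<kappa>_nonneg: "\<kappa> \<ge> 0"
    and \<phi>_zero: "\<phi> 0 = 0" and \<phi>_diff: "\<phi> differentiable_on {0..}"
    and \<phi>_mono: "strict_mono_on {0..} \<phi>" and \<phi>_convex: "convex_on {0..} \<phi>"
begin

lemma \<phi>_nonneg: "R \<ge> 0 \<Longrightarrow> \<phi> R \<ge> 0"
  using strict_mono_onD[OF \<phi>_mono, of 0 R] \<phi>_zero by (cases "R = 0") auto

text \<open>Positive points are interior to the half-line, so differentiability relative to it is
  the two-sided notion behind \<open>deriv\<close>.\<close>

lemma \<phi>_has_derivative:
  assumes "R > 0" shows "(\<phi> has_real_derivative deriv \<phi> R) (at R)"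
proof -
  have "\<phi> differentiable (at R within {0..})"
    using \<phi>_diff assms by (simp add: differentiable_on_def)
  moreover have "at R within {0..} = at R"
    using assms by (intro at_within_interior) simp
  ultimately have "\<phi> differentiable at R" by simp
  then show ?thesis using DERIV_deriv_iff_real_differentiable by blast
qed

lemma \<phi>_tangent:
  assumes "R > 0" "T \<ge> 0" shows "\<phi> R + deriv \<phi> R * (T - R) \<le> \<phi> T"
  using convex_on_imp_above_tangent[OF \<phi>_convex _ _ _
      has_field_derivative_at_within[OF \<phi>_has_derivative[OF assms(1)]], of T] assms
  by simp

lemma g_fun_zero: "g_fun \<phi> 0 = 0"
  by (simp add: g_fun_def \<phi>_zero)

text \<open>Adding the tangent inequalities at \<open>R\<close> and \<open>T\<close> shows that
  \<open>deriv \<phi>\<close> is nondecreasing; the tangent at \<open>T\<close>, evaluated at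
  \<open>R\<close>, then compares the two values.\<close>

lemma g_fun_mono:
  assumes "0 < R" "R \<le> T" shows "g_fun \<phi> R \<le> g_fun \<phi> T"
proof (cases "R = T")
  case False
  have 1: "\<phi> R + deriv \<phi> R * (T - R) \<le> \<phi> T" and 2: "\<phi> T + deriv \<phi> T * (R - T) \<le> \<phi> R"
    using assms by (auto intro: \<phi>_tangent)
  have eq: "deriv \<phi> T * (R - T) = R * deriv \<phi> T - T * deriv \<phi> T"
    "deriv \<phi> T * (R - T) = - (deriv \<phi> T * (T - R))" by (simp_all add: algebra_simps)
  have "deriv \<phi> R * (T - R) \<le> deriv \<phi> T * (T - R)"
    using 1 2 eq by linarith
  then have "deriv \<phi> R \<le> deriv \<phi> T" using assms False by simp
  then have "R * deriv \<phi> R \<le> R * deriv \<phi> T" using assms by simp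
  with 2 eq show ?thesis unfolding g_fun_def by linarith
qed simp

text \<open>The counterpart of \<open>gap\<close> for the circuit power
  \<open>F s = \<kappa> * \<phi> (B * s)\<close>: it is \<open>s * F' s - F s\<close>.\<close>

definition load :: "real \<Rightarrow> real" where
  "load s = \<kappa> * g_fun \<phi> (B * s)"

lemma load_zero: "load 0 = 0"
  by (simp add: load_def g_fun_zero)

lemma load_mono: "0 < s \<Longrightarrow> s \<le> t \<Longrightarrow> load s \<le> load t"
  using B_pos \<kappa>_nonneg by (auto simp: load_def intro!: mult_left_mono g_fun_mono)

lemma load_nonneg:
  assumes "s > 0" shows "load s \<ge> 0"
  using \<phi>_tangent[of "B * s" 0] assms B_pos \<kappa>_nonneg \<phi>_zero
  unfolding load_def g_fun_def by (intro mult_nonneg_nonneg) (auto simp: algebra_simps)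

abbreviation consumption :: "real \<Rightarrow> real \<Rightarrow> real" where
  "consumption \<equiv> total_power B \<xi> Pc \<kappa> \<phi> \<rho>"

definition consumption_slope :: "real \<Rightarrow> real \<Rightarrow> real" where
  "consumption_slope v s = \<kappa> * (B * deriv \<phi> (B * s)) + v / \<xi> * m s"

text \<open>The left side is the numerator of the derivative of \<open>consumption v s / s\<close>.
  Stationarity thus becomes the balance equation
  \<open>load s + v / \<xi> * gap s = Pc\<close>.\<close>

lemma consumption_slope_balance: "s * consumption_slope v s - consumption v s = load s + v / \<xi> * gap s - Pc"
  by (simp add: consumption_slope_def total_power_def load_def g_fun_def gap_def algebra_simps)

lemma consumption_lower:
  assumes "v \<ge> 0" "s \<ge> 0" shows "Pc \<le> consumption v s"
  using assms \<xi>_pos \<kappa>_nonneg B_pos \<phi>_nonneg[of "B * s"] nonneg[of s] by (simp add: total_power_def)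

lemma consumption_has_derivative:
  assumes "s > 0" shows "(consumption v has_real_derivative consumption_slope v s) (at s)"
proof -
  have "((\<lambda>s. \<phi> (B * s)) has_real_derivative deriv \<phi> (B * s) * B) (at s)"
    using assms B_pos by (intro DERIV_chain2[OF \<phi>_has_derivative]) (auto intro!: derivative_eq_intros)
  then show ?thesis
    unfolding total_power_def[abs_def] consumption_slope_def
    using has_derivative_slope[OF assms]
    using \<xi>_pos by (auto intro!: derivative_eq_intros simp: mult_ac)
qed

text \<open>Strictness comes from \<open>\<rho>\<close>, entering with the positive weight
  \<open>v / \<xi>\<close>; \<open>\<phi>\<close> contributes a weak inequality and may be
  linear.\<close>

lemma consumption_strict_tangent:
  assumes "v > 0" "s > 0" "t > 0" "t \<noteq> s"
  shows "consumption v s + consumption_slope v s * (t - s) < consumption v t"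
proof -
  have "\<kappa> * (\<phi> (B * s) + deriv \<phi> (B * s) * (B * t - B * s)) \<le> \<kappa> * \<phi> (B * t)"
    using assms B_pos \<kappa>_nonneg by (intro mult_left_mono \<phi>_tangent) auto
  moreover have "v / \<xi> * (\<rho> s + m s * (t - s)) < v / \<xi> * \<rho> t"
    using assms \<xi>_pos by (intro mult_strict_left_mono strict_tangent) auto
  moreover have "consumption v s + consumption_slope v s * (t - s) =
      \<kappa> * (\<phi> (B * s) + deriv \<phi> (B * s) * (B * t - B * s)) + v / \<xi> * (\<rho> s + m s * (t - s)) + Pc"
    by (simp add: total_power_def consumption_slope_def algebra_simps flip: add_divide_distrib)
  ultimately show ?thesis unfolding total_power_def[of _ _ _ _ _ _ _ t] by linarith
qed

text \<open>An overshoot at \<open>a\<close> says that \<open>consumption v s / s\<close> increases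
  at \<open>a\<close>, so a stationary point lies to its left. The case \<open>v = 0\<close> is
  included because it produces roots of \<open>load s = Pc\<close>.\<close>

lemma balanced_exists:
  assumes "v \<ge> 0" "a > 0" "load a + v / \<xi> * gap a > Pc"
  obtains s where "0 < s" "s < a" "load s + v / \<xi> * gap s = Pc"
proof (rule stationary_ratio_exists[OF consumption_has_derivative Pc_pos consumption_lower \<open>a > 0\<close>])
  show "consumption v a < a * consumption_slope v a"
    using consumption_slope_balance[of a v] assms by linarith
next
  fix s assume "0 < s" "s < a" "s * consumption_slope v s = consumption v s"
  then show thesis using that consumption_slope_balance[of s v] by simp
qed (use assms in auto)

lemma balanced_exists':
  assumes "v > 0" obtains s where "s > 0" "load s + v / \<xi> * gap s = Pc"
proof -
  obtain a where a: "a > 0" "gap a > Pc * \<xi> / v" using gap_unbounded by blast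
  then have "v / \<xi> * gap a > Pc"
    using assms \<xi>_pos by (simp add: field_simps)
  with load_nonneg[OF a(1)] have "load a + v / \<xi> * gap a > Pc" by simp
  then show thesis using balanced_exists[of v a] assms a that by auto
qed

abbreviation energy :: "real \<Rightarrow> real \<Rightarrow> ereal" where
  "energy \<equiv> energy_per_bit B \<xi> Pc \<kappa> \<phi> \<rho>"

text \<open>At a balanced point the tangent of \<open>consumption v\<close> passes through the
  origin. The curve lies strictly above this line elsewhere, so every other ray from the origin to
  the curve is steeper.\<close>

lemma energy_less_of_balanced:
  assumes "v > 0" "s > 0" "load s + v / \<xi> * gap s = Pc" "t \<ge> 0" "t \<noteq> s"
  shows "energy v s < energy v t"
proof (cases "t = 0")
  case False
  then have t: "t > 0" using assms by simp
  have eq: "s * consumption_slope v s = consumption v s" using consumption_slope_balance[of s v] assms by simp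
  have "consumption v s * t = s * (consumption v s + consumption_slope v s * (t - s))"
    using eq by (simp add: algebra_simps)
  also have "\<dots> < s * consumption v t"
    using consumption_strict_tangent[of v s t] assms t by simp
  finally have "consumption v s / (B * s) < consumption v t / (B * t)"
    using assms t B_pos by (simp add: field_simps)
  then show ?thesis using assms t by (simp add: energy_per_bit_def)
qed (use assms in \<open>simp add: energy_per_bit_def\<close>)

abbreviation best_rate :: "real \<Rightarrow> real" where
  "best_rate \<equiv> opt_rate B \<xi> Pc \<kappa> \<phi> \<rho>"

lemma best_rate_eq:
  assumes "v > 0" "s > 0" "load s + v / \<xi> * gap s = Pc"
  shows "best_rate v = s"
  unfolding opt_rate_def
proof (rule the_equality)
  show "is_arg_min (energy v) (\<lambda>s. 0 \<le> s) s"
    using energy_less_of_balanced[OF assms] assms(2)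
    by (force simp: is_arg_min_def)
  show "t = s" if "is_arg_min (energy v) (\<lambda>s. 0 \<le> s) t" for t
    using that energy_less_of_balanced[OF assms, of t] assms(2)
    by (auto simp: is_arg_min_def)
qed

lemma best_rate:
  assumes "v > 0"
  shows "best_rate v > 0" "load (best_rate v) + v / \<xi> * gap (best_rate v) = Pc"
  using balanced_exists'[OF assms] best_rate_eq[OF assms] by metis+

lemma energy_best_rate_le:
  assumes "v > 0" "t \<ge> 0" shows "energy v (best_rate v) \<le> energy v t"
  using energy_less_of_balanced[OF assms(1) best_rate[OF assms(1)] assms(2)]
  by (cases "t = best_rate v") auto

lemma opt_energy_eq:
  assumes "v > 0" shows "opt_energy B \<xi> Pc \<kappa> \<phi> \<rho> v = energy v (best_rate v)"
  unfolding opt_energy_def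
  by (rule Least_equality) (use best_rate[OF assms] energy_best_rate_le[OF assms] in \<open>auto intro: less_imp_le\<close>)

text \<open>Evaluate both energies at the optimal rate for the larger noise \<open>w\<close>: it is
  a competitor for \<open>v\<close>, and \<open>\<rho>\<close> is positive there.\<close>

lemma opt_energy_strict_mono: "strict_mono_on {0<..} (opt_energy B \<xi> Pc \<kappa> \<phi> \<rho>)"
proof (rule strict_mono_onI)
  fix v w :: real assume vw: "v \<in> {0<..}" "w \<in> {0<..}" "v < w"
  then have w: "w > 0" and v: "v > 0" by auto
  let ?s = "best_rate w"
  have s: "?s > 0" using best_rate(1)[OF w] .
  have "v / \<xi> * \<rho> ?s < w / \<xi> * \<rho> ?s"
    using vw \<xi>_pos pos[OF s] by (simp add: divide_strict_right_mono)
  then have "energy v ?s < energy w ?s"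
    using s B_pos by (simp add: energy_per_bit_def total_power_def divide_strict_right_mono)
  then show "opt_energy B \<xi> Pc \<kappa> \<phi> \<rho> v < opt_energy B \<xi> Pc \<kappa> \<phi> \<rho> w"
    using energy_best_rate_le[OF v, of ?s] s opt_energy_eq v w by simp
qed

text \<open>The left side of the balance equation increases with the rate, so a point where it falls
  short of \<open>Pc\<close> lies below the root. With its mirror image
  \<open>best_rate_less\<close>, this reduces comparisons with \<open>best_rate\<close> to
  inequalities at a fixed point.\<close>

lemma less_best_rate:
  assumes "v > 0" "s > 0" "load s + v / \<xi> * gap s < Pc" shows "s < best_rate v"
proof (rule ccontr)
  assume "\<not> s < best_rate v"
  then have le: "best_rate v \<le> s" by simp
  have "gap (best_rate v) \<le> gap s"
    using le gap_less[OF best_rate(1)[OF assms(1)], of s] by (cases "best_rate v = s") auto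
  then have "v / \<xi> * gap (best_rate v) \<le> v / \<xi> * gap s"
    using assms \<xi>_pos by (intro mult_left_mono) auto
  with load_mono[OF best_rate(1)[OF assms(1)] le] best_rate(2)[OF assms(1)] assms show False
    by linarith
qed

lemma best_rate_less:
  assumes "v > 0" "s > 0" "load s + v / \<xi> * gap s > Pc" shows "best_rate v < s"
proof (rule ccontr)
  assume "\<not> best_rate v < s"
  then have le: "s \<le> best_rate v" by simp
  have "gap s \<le> gap (best_rate v)"
    using le gap_less[OF assms(2), of "best_rate v"] by (cases "best_rate v = s") auto
  then have "v / \<xi> * gap s \<le> v / \<xi> * gap (best_rate v)"
    using assms \<xi>_pos by (intro mult_left_mono) auto
  with load_mono[OF assms(2) le] best_rate(2)[OF assms(1)] assms show False
    by linarith
qed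

text \<open>At the optimal rate for \<open>v\<close>, raising the noise to \<open>w\<close> makes
  the left side of the balance equation exceed \<open>Pc\<close>, as \<open>gap\<close> is
  positive.\<close>

lemma best_rate_strict_antimono: "strict_antimono_on {0<..} best_rate"
proof (rule monotone_onI)
  fix v w :: real assume vw: "v \<in> {0<..}" "w \<in> {0<..}" "v < w"
  have "v / \<xi> * gap (best_rate v) < w / \<xi> * gap (best_rate v)"
    using vw \<xi>_pos gap_pos[OF best_rate(1), of v] by (simp add: divide_strict_right_mono)
  then show "best_rate w < best_rate v"
    using vw best_rate[of v] by (intro best_rate_less) auto
qed

lemma best_rate_tendsto_0: "(best_rate \<longlongrightarrow> 0) at_top"
proof (rule tendstoI)
  fix e :: real assume e: "e > 0"
  show "\<forall>\<^sub>F v in at_top. dist (best_rate v) 0 < e"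
    \<comment> \<open>Beyond this noise level the term \<open>v / \<xi> * gap e\<close> alone
      exceeds \<open>Pc\<close>.\<close>
    using eventually_gt_at_top[of "max 0 (Pc * \<xi> / gap e)"]
  proof eventually_elim
    case (elim v)
    then have "v / \<xi> * gap e > Pc"
      using gap_pos[OF e] \<xi>_pos by (simp add: field_simps)
    with load_nonneg[OF e] have "best_rate v < e" using elim e by (intro best_rate_less) auto
    then show ?case using best_rate(1)[of v] elim by simp
  qed
qed

lemma eventually_less_best_rate:
  assumes "s > 0" "load s < Pc" shows "\<forall>\<^sub>F v in at_right 0. s < best_rate v"
proof -
  \<comment> \<open>For noise below \<open>d\<close>, \<open>v / \<xi> * gap s\<close> is smaller
    than the slack \<open>Pc - load s\<close>.\<close>
  define d where "d = (Pc - load s) * \<xi> / gap s"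
  have "d > 0" using assms gap_pos \<xi>_pos by (simp add: d_def)
  then have "\<forall>\<^sub>F v in at_right 0. v \<in> {0<..<d}" by (rule eventually_at_right_real)
  then show ?thesis
  proof eventually_elim
    case (elim v)
    then have "v / \<xi> * gap s < Pc - load s"
      using gap_pos[OF assms(1)] \<xi>_pos by (simp add: d_def field_simps)
    then show ?case using elim assms by (intro less_best_rate) auto
  qed
qed

lemma load_best_rate_less:
  assumes "v > 0" shows "load (best_rate v) < Pc"
  using best_rate[OF assms] gap_pos[OF best_rate(1)[OF assms]] assms \<xi>_pos
    mult_pos_pos[of "v / \<xi>" "gap (best_rate v)"]
  by (metis divide_pos_pos less_add_same_cancel1)

text \<open>As \<open>best_rate\<close> is antitone, its limit at 0 is its supremum
  \<open>L\<close>. If \<open>load L < Pc\<close>, some rates would exceed \<open>L\<close>; and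
  \<open>L\<close> is at most every root of \<open>load t = Pc\<close>, whence
  \<open>load L \<le> Pc\<close>. So \<open>L\<close> is the least root, found without continuity of
  \<open>load\<close>.\<close>

lemma best_rate_tendsto_balance:
  assumes "s \<ge> 0" "load s = Pc"
  shows "\<exists>s2\<ge>0. load s2 = Pc \<and> (best_rate \<longlongrightarrow> s2) (at_right 0)"
proof -
  have below: "best_rate v \<le> t" if "v > 0" "t \<ge> 0" "load t = Pc" for v t
    using load_mono[of t "best_rate v"] load_best_rate_less[OF that(1)] that load_zero Pc_pos
    by (cases "t = 0") force+
  define L where "L = Sup (best_rate ` {0<..})"
  have bdd: "bdd_above (best_rate ` {0<..})"
    using below assms by (intro bdd_aboveI[of _ s]) auto
  have le_L: "best_rate v \<le> L" if "v > 0" for v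
    unfolding L_def using bdd that by (intro cSup_upper) auto
  have L_pos: "L > 0" using le_L[of 1] best_rate(1)[of 1] by simp
  have "\<not> load L < Pc"
  proof
    assume "load L < Pc"
    then have "\<forall>\<^sub>F v in at_right 0. L < best_rate v" using L_pos by (rule eventually_less_best_rate[rotated])
    moreover have "\<forall>\<^sub>F v in at_right (0::real). v > 0" by (rule eventually_at_right_less)
    ultimately have "\<forall>\<^sub>F v in at_right (0::real). False"
      by eventually_elim (use le_L in force)
    then show False by simp
  qed
  moreover have "L \<le> s"
    unfolding L_def using below assms by (intro cSup_least) auto
  then have "load L \<le> Pc" using load_mono[OF L_pos, of s] assms by simp
  ultimately have "load L = Pc" by simp
  moreover have "(best_rate \<longlongrightarrow> L) (at_right 0)"
  proof (rule order_tendstoI)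
    fix a assume "a < L"
    then obtain v where v: "v > 0" "a < best_rate v"
      unfolding L_def using less_cSup_iff[OF _ bdd, of a] by auto
    have "\<forall>\<^sub>F w in at_right 0. w \<in> {0<..<v}" using v(1) by (rule eventually_at_right_real)
    then show "\<forall>\<^sub>F w in at_right 0. a < best_rate w"
    proof eventually_elim
      case (elim w)
      then show ?case
        using monotone_onD[OF best_rate_strict_antimono, of w v] v by auto
    qed
  next
    fix a assume "L < a"
    have "\<forall>\<^sub>F v in at_right (0::real). v > 0" by (rule eventually_at_right_less)
    then show "\<forall>\<^sub>F v in at_right 0. best_rate v < a"
      by eventually_elim (use le_L \<open>L < a\<close> in force)
  qed
  ultimately show ?thesis using L_pos by (intro exI[of _ L]) auto
qed

lemma best_rate_at_top:
  assumes "\<And>s. s \<ge> 0 \<Longrightarrow> load s \<noteq> Pc"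
  shows "filterlim best_rate at_top (at_right 0)"
proof (rule filterlim_at_top_gt[THEN iffD2, rule_format, of 0])
  fix s :: real assume s: "s > 0"
  \<comment> \<open>At zero noise the balance equation reads \<open>load s = Pc\<close>, so an
    overshoot at \<open>s\<close> would create a root.\<close>
  have "\<not> load s > Pc"
    using balanced_exists[of 0 s] assms s by fastforce
  then have "load s < Pc" using assms[of s] s by force
  then show "\<forall>\<^sub>F v in at_right 0. s \<le> best_rate v"
    using eventually_less_best_rate[OF s] by (auto elim: eventually_mono)
qed

end

section \<open>Power curves of the channels\<close>

text \<open>The curve is parametrised by \<open>x\<close>, with rate \<open>S x\<close> and slope
  \<open>w x\<close>; the slope function is \<open>w\<close> composed with the inverse
  \<open>X\<close> of \<open>S\<close> on positive rates. Strict growth of \<open>S\<close> is asked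
  for only where \<open>S\<close> is positive, since the water-filling rate vanishes at low levels
  when the gain is bounded.\<close>

lemma power_curve_of_parametrization:
  fixes S w \<rho> :: "real \<Rightarrow> real"
  assumes S_cont: "continuous_on {0..} S" and S_0: "S 0 = 0"
    and S_mono: "\<And>x y. 0 \<le> x \<Longrightarrow> x \<le> y \<Longrightarrow> S x \<le> S y"
    and S_less: "\<And>x y. 0 < x \<Longrightarrow> x < y \<Longrightarrow> S x > 0 \<Longrightarrow> S x < S y"
    and S_unbounded: "\<And>K. \<exists>x\<ge>0. S x > K"
    and w_cont: "continuous_on {0<..} w" and w_mono: "strict_mono_on {0<..} w"
    and w_unbounded: "\<And>K. \<exists>x>0. w x > K"
    and zero: "\<rho> 0 = 0" and nonneg: "\<And>s. s \<ge> 0 \<Longrightarrow> \<rho> s \<ge> 0"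
    and tangent: "\<And>x t. x > 0 \<Longrightarrow> S x > 0 \<Longrightarrow> t \<ge> 0 \<Longrightarrow> \<rho> (S x) + w x * (t - S x) \<le> \<rho> t"
  shows "\<exists>m. power_curve \<rho> m"
proof -
  have "\<exists>x>0. S x = s" if s: "s > 0" for s
  proof -
    obtain y where y: "y \<ge> 0" "S y > s" using S_unbounded by blast
    have "continuous_on {0..y} S" using S_cont by (rule continuous_on_subset) auto
    then obtain x where x: "0 \<le> x" "S x = s"
      using IVT'[of S 0 s y] y S_0 s by force
    then have "x \<noteq> 0" using S_0 s by auto
    with x show ?thesis by (intro exI[of _ x]) auto
  qed
  then obtain X where X: "\<And>s. s > 0 \<Longrightarrow> X s > 0" "\<And>s. s > 0 \<Longrightarrow> S (X s) = s" by metis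
  have X_S: "X (S x) = x" if "x > 0" "S x > 0" for x
    using S_less[of x "X (S x)"] S_less[of "X (S x)" x] X[OF that(2)] that
    by (metis less_irrefl linorder_neqE_linordered_idom)
  have X_less: "X s < X t" if "0 < s" "s < t" for s t
    using S_mono[of "X t" "X s"] X[of s] X[of t] that by force
  \<comment> \<open>A monotone function with open image is continuous; here the image is the set of
    positive parameters with positive rate.\<close>
  have "X ` {0<..} = {0<..} \<inter> S -` {0<..}"
    using X X_S by (force intro!: image_eqI[of _ X])
  moreover have "open ({0<..} \<inter> S -` {0<..})"
    by (intro continuous_open_preimage continuous_on_subset[OF S_cont]) auto
  ultimately have "continuous_on {0<..} X"
    using X_less by (intro continuous_onI_mono) (auto simp: le_less)
  then have cont: "continuous_on {0<..} (\<lambda>s. w (X s))"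
    by (rule continuous_on_compose2[OF w_cont]) (use X in auto)
  have "power_curve \<rho> (\<lambda>s. w (X s))"
  proof
    show "\<rho> s + w (X s) * (t - s) \<le> \<rho> t" if "s > 0" "t \<ge> 0" for s t
      using tangent[of "X s" t] X that by simp
    show "strict_mono_on {0<..} (\<lambda>s. w (X s))"
      using X X_less w_mono by (auto simp: strict_mono_on_def)
    show "\<exists>s>0. w (X s) > K" for K
    proof -
      obtain x where x: "x > 0" "w x > K" using w_unbounded by blast
      \<comment> \<open>The rate \<open>S y\<close> exceeds \<open>S x\<close>, so its parameter
        lies beyond \<open>x\<close>, where \<open>w\<close> is already above
        \<open>K\<close>.\<close>
      obtain y where y: "y \<ge> 0" "S y > max 0 (S x)" using S_unbounded by blast
      then have "x < X (S y)"
        using S_mono[of "X (S y)" x] X[of "S y"] by force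
      then have "w x < w (X (S y))"
        using w_mono x by (auto simp: strict_mono_on_def)
      with x y show ?thesis by (intro exI[of _ "S y"]) auto
    qed
  qed (use zero nonneg cont in auto)
  then show ?thesis by blast
qed

section \<open>Static channel\<close>

lemma power_curve_static:
  assumes "G > 0" shows "\<exists>m. power_curve (rho_static G) m"
proof -
  have rho: "rho_static G s = (2 powr s - 1) / G" if "s \<ge> 0" for s
    unfolding rho_static_def
  proof (rule Least_equality)
    have "2 powr s \<ge> 1" using that by (simp add: ge_one_powr_ge_zero)
    then show "0 \<le> (2 powr s - 1) / G \<and> s \<le> log 2 (1 + G * ((2 powr s - 1) / G))"
      using assms by simp
    show "(2 powr s - 1) / G \<le> p" if "0 \<le> p \<and> s \<le> log 2 (1 + G * p)" for p
    proof -
      have "1 + G * p > 0" using assms that by (simp add: add_pos_nonneg)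
      then have "2 powr s \<le> 1 + G * p" using that by (simp add: le_log_iff)
      then show ?thesis using assms by (simp add: field_simps)
    qed
  qed
  have "power_curve (rho_static G) (\<lambda>s. 2 powr s * ln 2 / G)"
  proof
    show "rho_static G 0 = 0" using rho[of 0] by simp
    show "rho_static G s \<ge> 0" if "s \<ge> 0" for s
      using rho[OF that] that assms by (simp add: ge_one_powr_ge_zero)
    show "rho_static G s + 2 powr s * ln 2 / G * (t - s) \<le> rho_static G t" if "s > 0" "t \<ge> 0" for s t
    proof -
      \<comment> \<open>The supporting line of \<open>2 powr t\<close> at \<open>s\<close> is the
        bound \<open>1 + x \<le> exp x\<close>, rescaled.\<close>
      have "1 + (t - s) * ln 2 \<le> exp ((t - s) * ln 2)" by (rule exp_ge_add_one_self)
      also have "\<dots> = 2 powr t / 2 powr s" by (simp add: powr_def left_diff_distrib exp_diff)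
      finally have "2 powr s * (1 + (t - s) * ln 2) \<le> 2 powr t"
        by (simp add: field_simps)
      then have "(2 powr s * (1 + (t - s) * ln 2) - 1) / G \<le> (2 powr t - 1) / G"
        using assms by (intro divide_right_mono) auto
      moreover have "(2 powr s * (1 + (t - s) * ln 2) - 1) / G =
          (2 powr s - 1) / G + 2 powr s * ln 2 / G * (t - s)"
        by (simp add: algebra_simps flip: add_divide_distrib diff_divide_distrib)
      ultimately show ?thesis using that by (simp add: rho)
    qed
    show "continuous_on {0<..} (\<lambda>s. 2 powr s * ln 2 / G)"
      using assms by (intro continuous_intros) auto
    show "strict_mono_on {0<..} (\<lambda>s. 2 powr s * ln 2 / G)"
      using assms by (intro strict_mono_onI) (simp add: divide_strict_right_mono)
    show "\<exists>s>0. 2 powr s * ln 2 / G > K" for K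
    proof -
      \<comment> \<open>The slope at \<open>log 2 y\<close> is \<open>y * ln 2 / G\<close>; the
        bound \<open>y \<ge> 2\<close> keeps \<open>log 2 y\<close> positive.\<close>
      define y where "y = max 2 (K * G / ln 2 + 1)"
      have "y > K * G / ln 2" "y \<ge> 2" by (auto simp: y_def)
      then have "2 powr log 2 y * ln 2 / G > K" "log 2 y > 0"
        using assms by (simp_all add: field_simps)
      then show ?thesis by blast
    qed
  qed
  then show ?thesis by blast
qed

section \<open>Parameter integrals and estimates for the logarithmic rate\<close>

lemma continuous_on_integral_of_dominated:
  fixes f :: "real \<Rightarrow> 'a \<Rightarrow> real"
  assumes meas: "\<And>x. x \<in> S \<Longrightarrow> f x \<in> borel_measurable M"
    and cont: "AE \<omega> in M. continuous_on S (\<lambda>x. f x \<omega>)"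
    and bound: "\<And>T. compact T \<Longrightarrow> T \<noteq> {} \<Longrightarrow> T \<subseteq> S \<Longrightarrow>
      \<exists>b. integrable M b \<and> (\<forall>x\<in>T. AE \<omega> in M. norm (f x \<omega>) \<le> b \<omega>)"
  shows "continuous_on S (\<lambda>x. \<integral>\<omega>. f x \<omega> \<partial>M)"
proof (rule continuous_on_sequentiallyI)
  fix u a assume u: "\<forall>n. u n \<in> S" "a \<in> S" "u \<longlonglongrightarrow> a"
  \<comment> \<open>A convergent sequence together with its limit is compact, so a single bound
    dominates all its members.\<close>
  obtain b where b: "integrable M b" "\<And>x. x \<in> insert a (range u) \<Longrightarrow> AE \<omega> in M. norm (f x \<omega>) \<le> b \<omega>"
    using bound[OF compact_sequence_with_limit[OF u(3)]] u by blast
  show "(\<lambda>n. \<integral>\<omega>. f (u n) \<omega> \<partial>M) \<longlonglongrightarrow> (\<integral>\<omega>. f a \<omega> \<partial>M)"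
  proof (rule integral_dominated_convergence)
    show "AE \<omega> in M. (\<lambda>n. f (u n) \<omega>) \<longlonglongrightarrow> f a \<omega>"
      using cont
    proof eventually_elim
      case (elim \<omega>)
      then show ?case
        using u by (auto simp: continuous_on_sequentially o_def)
    qed
  qed (use u b meas in auto)
qed

lemma log2_rate_bounds:
  fixes g p :: real
  assumes "g \<ge> 0" "p \<ge> 0"
  shows "0 \<le> log 2 (1 + g * p)" "log 2 (1 + g * p) \<le> log 2 (1 + g) + log 2 (1 + p)"
proof -
  have gp: "g * p \<ge> 0" using assms by simp
  then show "0 \<le> log 2 (1 + g * p)" by simp
  have "log 2 (1 + g * p) \<le> log 2 ((1 + g) * (1 + p))"
    using assms gp by (subst log_le_cancel_iff) (auto simp: algebra_simps add_pos_nonneg)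
  then show "log 2 (1 + g * p) \<le> log 2 (1 + g) + log 2 (1 + p)"
    using assms by (simp add: log_mult)
qed

text \<open>This is Bernoulli's inequality \<open>(1 + p) powr h \<le> 1 + h * p\<close> for
  \<open>h = min 1 g\<close>, obtained from convexity of \<open>exp\<close>. Truncating the gain at
  1 makes the factor integrable.\<close>

lemma log2_rate_ge_min:
  fixes g p :: real
  assumes "g \<ge> 0" "p \<ge> 0"
  shows "min 1 g * log 2 (1 + p) \<le> log 2 (1 + g * p)"
proof -
  define h where "h = min 1 g"
  define L where "L = ln (1 + p)"
  have h: "0 \<le> h" "h \<le> 1" "h \<le> g" using assms by (auto simp: h_def)
  have L: "exp L = 1 + p" using assms by (simp add: L_def)
  have "exp (h * L) \<le> 1 + h * p"
    using convex_onD[OF exp_convex h(1,2), of 0 L] L by (simp add: algebra_simps)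
  also have "\<dots> \<le> 1 + g * p" using h assms by (simp add: mult_right_mono)
  finally have "exp (h * L) \<le> 1 + g * p" .
  moreover have "1 + g * p > 0" using assms by (simp add: add_pos_nonneg)
  ultimately have "h * L \<le> ln (1 + g * p)" by (simp add: ln_ge_iff)
  then show ?thesis
    by (simp add: h_def[symmetric] L_def log_def divide_right_mono)
qed

lemma log2_tangent:
  fixes x y :: real
  assumes "x > 0" "y > 0"
  shows "log 2 x \<le> log 2 y + (x - y) / y / ln 2"
proof -
  have "ln (x / y) \<le> x / y - 1" using assms by (intro ln_le_minus_one) auto
  then have "ln x \<le> ln y + (x - y) / y" using assms by (simp add: ln_div diff_divide_distrib)
  then have "ln x / ln 2 \<le> (ln y + (x - y) / y) / ln 2" by (intro divide_right_mono) auto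
  then show ?thesis by (simp add: log_def add_divide_distrib)
qed

section \<open>Fading channel known in distribution\<close>

locale positive_gain = prob_space M for M :: "'a measure" +
  fixes G :: "'a \<Rightarrow> real"
  assumes G_measurable[measurable]: "G \<in> borel_measurable M"
    and G_pos: "AE \<omega> in M. 0 < G \<omega>"
    and unit_rate_integrable: "integrable M (\<lambda>\<omega>. log 2 (1 + G \<omega>))"
begin

definition rate :: "real \<Rightarrow> real" where
  "rate p = (\<integral>\<omega>. log 2 (1 + G \<omega> * p) \<partial>M)"

lemma rate_AE_bound:
  assumes "0 \<le> p" "p \<le> K"
  shows "AE \<omega> in M. norm (log 2 (1 + G \<omega> * p)) \<le> log 2 (1 + G \<omega>) + log 2 (1 + K)"
  using G_pos
proof eventually_elim
  case (elim \<omega>)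
  then have b: "0 \<le> log 2 (1 + G \<omega> * p)" "log 2 (1 + G \<omega> * p) \<le> log 2 (1 + G \<omega>) + log 2 (1 + p)"
    using log2_rate_bounds[of "G \<omega>" p] assms by auto
  moreover have "log 2 (1 + p) \<le> log 2 (1 + K)" using assms by simp
  ultimately show ?case unfolding real_norm_def abs_of_nonneg[OF b(1)] by linarith
qed

lemma bound_integrable: "integrable M (\<lambda>\<omega>. log 2 (1 + G \<omega>) + c)"
  using unit_rate_integrable by simp

lemma rate_integrable:
  assumes "p \<ge> 0" shows "integrable M (\<lambda>\<omega>. log 2 (1 + G \<omega> * p))"
  by (rule Bochner_Integration.integrable_bound[OF bound_integrable[of "log 2 (1 + p)"]])
    (use rate_AE_bound[OF assms order.refl] in \<open>auto elim: eventually_mono\<close>)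

lemma rate_0: "rate 0 = 0"
  by (simp add: rate_def)

lemma rate_less:
  assumes "0 \<le> p" "p < q" shows "rate p < rate q"
  unfolding rate_def
proof (rule integral_less_AE_space)
  show "AE \<omega> in M. log 2 (1 + G \<omega> * p) < log 2 (1 + G \<omega> * q)"
    using G_pos
  proof eventually_elim
    case (elim \<omega>)
    then show ?case using assms by (subst log_less_cancel_iff) (auto simp: add_pos_nonneg)
  qed
qed (use assms in \<open>auto intro!: rate_integrable simp: emeasure_space_1\<close>)

lemma rate_cont: "continuous_on {0..} rate"
  unfolding rate_def[abs_def]
proof (rule continuous_on_integral_of_dominated)
  show "AE \<omega> in M. continuous_on {0..} (\<lambda>p. log 2 (1 + G \<omega> * p))"
    using G_pos
  proof eventually_elim
    case (elim \<omega>)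
    then have "1 + G \<omega> * p > 0" if "p \<ge> 0" for p using that by (simp add: add_pos_nonneg)
    then show ?case by (intro continuous_intros) force+
  qed
next
  fix T :: "real set" assume T: "compact T" "T \<noteq> {}" "T \<subseteq> {0..}"
  then obtain K where "K \<in> T" "\<And>p. p \<in> T \<Longrightarrow> p \<le> K" using compact_attains_sup by metis
  then show "\<exists>b. integrable M b \<and> (\<forall>p\<in>T. AE \<omega> in M. norm (log 2 (1 + G \<omega> * p)) \<le> b \<omega>)"
    using T rate_AE_bound bound_integrable
    by (intro exI[of _ "\<lambda>\<omega>. log 2 (1 + G \<omega>) + log 2 (1 + K)"]) auto
qed simp

text \<open>The truncated gain has positive mean \<open>a\<close>, so
  \<open>rate p \<ge> a * log 2 (1 + p)\<close>, which is unbounded.\<close>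

lemma rate_unbounded: "\<exists>p\<ge>0. rate p > K"
proof -
  define a where "a = (\<integral>\<omega>. min 1 (G \<omega>) \<partial>M)"
  have int: "integrable M (\<lambda>\<omega>. min 1 (G \<omega>))"
    by (rule integrable_const_bound[of _ 1]) (use G_pos in \<open>auto elim!: eventually_mono\<close>)
  have "(\<integral>\<omega>. 0 \<partial>M) < a"
    unfolding a_def
    by (rule integral_less_AE_space) (use G_pos int in \<open>auto simp: emeasure_space_1 elim!: eventually_mono\<close>)
  then have a: "a > 0" by simp
  \<comment> \<open>Chosen so that \<open>a * log 2 (1 + p) = max 0 K + a\<close>; the maximum with
    0 ensures \<open>p \<ge> 0\<close>.\<close>
  define p where "p = 2 powr (max 0 K / a + 1) - 1"
  have p: "p \<ge> 0" using a by (simp add: p_def ge_one_powr_ge_zero)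
  have "a * log 2 (1 + p) = max 0 K + a" using a by (simp add: p_def distrib_left)
  then have "K < a * log 2 (1 + p)" using a by linarith
  also have "\<dots> = (\<integral>\<omega>. min 1 (G \<omega>) * log 2 (1 + p) \<partial>M)"
    by (simp add: a_def)
  also have "\<dots> \<le> rate p"
    unfolding rate_def
  proof (rule integral_mono_AE)
    show "AE \<omega> in M. min 1 (G \<omega>) * log 2 (1 + p) \<le> log 2 (1 + G \<omega> * p)"
      using G_pos by eventually_elim (use p in \<open>auto intro!: log2_rate_ge_min\<close>)
  qed (use int p rate_integrable in auto)
  finally show ?thesis using p by blast
qed

text \<open>Up to the factor \<open>1 / ln 2\<close>, this is the derivative of \<open>rate\<close>
  taken under the integral. For \<open>p > 0\<close> the integrand is at most \<open>1 / p\<close>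
  almost surely; at \<open>p = 0\<close> it is the gain, whose mean may be infinite.\<close>

definition rate_slope :: "real \<Rightarrow> real" where
  "rate_slope p = (\<integral>\<omega>. G \<omega> / (1 + G \<omega> * p) \<partial>M)"

lemma rate_slope_AE_bound:
  assumes "0 < c" "c \<le> p"
  shows "AE \<omega> in M. norm (G \<omega> / (1 + G \<omega> * p)) \<le> 1 / c"
  using G_pos
proof eventually_elim
  case (elim \<omega>)
  then have "G \<omega> * c \<le> G \<omega> * p" "0 < G \<omega> * p" using assms by auto
  then have "G \<omega> * c \<le> 1 + G \<omega> * p" "0 < 1 + G \<omega> * p" by linarith+
  then show ?case using elim assms by (simp add: pos_divide_le_eq le_divide_eq)
qed

lemma rate_slope_integrable:
  assumes "p > 0" shows "integrable M (\<lambda>\<omega>. G \<omega> / (1 + G \<omega> * p))"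
  by (rule integrable_const_bound[OF rate_slope_AE_bound[OF assms order.refl]]) simp

lemma rate_slope_pos:
  assumes "p > 0" shows "rate_slope p > 0"
proof -
  have "(\<integral>\<omega>. 0 \<partial>M) < rate_slope p"
    unfolding rate_slope_def
    by (rule integral_less_AE_space)
      (use G_pos rate_slope_integrable assms in
        \<open>auto simp: emeasure_space_1 add_pos_pos elim!: eventually_mono\<close>)
  then show ?thesis by simp
qed

lemma rate_slope_less:
  assumes "0 < p" "p < q" shows "rate_slope q < rate_slope p"
  unfolding rate_slope_def
proof (rule integral_less_AE_space)
  show "AE \<omega> in M. G \<omega> / (1 + G \<omega> * q) < G \<omega> / (1 + G \<omega> * p)"
    using G_pos
  proof eventually_elim
    case (elim \<omega>)
    then have "1 + G \<omega> * p > 0" "1 + G \<omega> * p < 1 + G \<omega> * q"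
      using assms by (auto simp: add_pos_pos)
    then show ?case using elim by (intro divide_strict_left_mono mult_pos_pos) linarith+
  qed
qed (use assms rate_slope_integrable in \<open>auto simp: emeasure_space_1\<close>)

lemma rate_slope_le:
  assumes "p > 0" shows "rate_slope p \<le> 1 / p"
proof -
  have "rate_slope p \<le> (\<integral>\<omega>. 1 / p \<partial>M)"
    unfolding rate_slope_def
  proof (rule integral_mono_AE)
    show "AE \<omega> in M. G \<omega> / (1 + G \<omega> * p) \<le> 1 / p"
      using rate_slope_AE_bound[OF assms order.refl] by eventually_elim (simp only: real_norm_def abs_le_iff)
  qed (use rate_slope_integrable[OF assms] in auto)
  then show ?thesis by (simp add: prob_space)
qed

lemma rate_slope_cont: "continuous_on {0<..} rate_slope"
  unfolding rate_slope_def[abs_def]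
proof (rule continuous_on_integral_of_dominated)
  show "AE \<omega> in M. continuous_on {0<..} (\<lambda>p. G \<omega> / (1 + G \<omega> * p))"
    using G_pos
  proof eventually_elim
    case (elim \<omega>)
    then have "1 + G \<omega> * p > 0" if "p > 0" for p using that by (simp add: add_pos_pos)
    then show ?case by (intro continuous_intros) force
  qed
next
  fix T :: "real set" assume T: "compact T" "T \<noteq> {}" "T \<subseteq> {0<..}"
  then obtain c where "c \<in> T" "\<And>p. p \<in> T \<Longrightarrow> c \<le> p" using compact_attains_inf by metis
  then show "\<exists>b. integrable M b \<and> (\<forall>p\<in>T. AE \<omega> in M. norm (G \<omega> / (1 + G \<omega> * p)) \<le> b \<omega>)"
    using T rate_slope_AE_bound[of c] by (intro exI[of _ "\<lambda>_. 1 / c"]) auto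
qed simp

text \<open>Integrating the pointwise tangent inequality of the logarithm replaces differentiation
  under the integral.\<close>

lemma rate_tangent:
  assumes "p > 0" "q \<ge> 0"
  shows "rate q \<le> rate p + rate_slope p * (q - p) / ln 2"
proof -
  define c where "c = (q - p) / ln 2"
  have int: "integrable M (\<lambda>\<omega>. log 2 (1 + G \<omega> * p))"
    "integrable M (\<lambda>\<omega>. G \<omega> / (1 + G \<omega> * p) * c)"
    using assms by (auto intro!: rate_integrable rate_slope_integrable integrable_mult_left
        simp del: times_divide_eq_left)
  have "rate q \<le> (\<integral>\<omega>. log 2 (1 + G \<omega> * p) + G \<omega> / (1 + G \<omega> * p) * c \<partial>M)"
    unfolding rate_def
  proof (rule integral_mono_AE)
    show "AE \<omega> in M. log 2 (1 + G \<omega> * q) \<le> log 2 (1 + G \<omega> * p) + G \<omega> / (1 + G \<omega> * p) * c"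
      using G_pos
    proof eventually_elim
      case (elim \<omega>)
      then have "1 + G \<omega> * q > 0" "1 + G \<omega> * p > 0" using assms by (auto simp: add_pos_nonneg)
      moreover have "1 + G \<omega> * q - (1 + G \<omega> * p) = G \<omega> * (q - p)" by (simp add: algebra_simps)
      ultimately show ?case
        using log2_tangent[of "1 + G \<omega> * q" "1 + G \<omega> * p"] by (simp add: c_def)
    qed
  qed (intro rate_integrable assms(2) int Bochner_Integration.integrable_add)+
  also have "\<dots> = rate p + rate_slope p * c"
    unfolding Bochner_Integration.integral_add[OF int] integral_mult_left_zero
    by (simp only: rate_def rate_slope_def)
  finally show ?thesis by (simp add: c_def)
qed

lemma rho_dist_known_rate:
  assumes "p \<ge> 0" shows "rho_dist_known M G (rate p) = p"
  unfolding rho_dist_known_def rate_def[symmetric]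
proof (rule Least_equality)
  show "p \<le> q" if "0 \<le> q \<and> rate p \<le> rate q" for q
    using rate_less[of q p] that by force
qed (use assms in auto)

lemma rate_surj:
  assumes "s \<ge> 0" obtains p where "p \<ge> 0" "rate p = s"
proof -
  obtain y where y: "y \<ge> 0" "rate y > s" using rate_unbounded by blast
  have "continuous_on {0..y} rate" using rate_cont by (rule continuous_on_subset) auto
  then show thesis
    using IVT'[of rate 0 s y] y rate_0 assms that by force
qed

text \<open>The parameter is the power itself. As \<open>rho_dist_known M G\<close> inverts
  \<open>rate\<close>, its slope is the reciprocal of the slope of \<open>rate\<close>, and
  \<open>rate_tangent\<close> becomes the supporting line. The bound \<open>1 / p\<close> on
  \<open>rate_slope p\<close> makes this reciprocal unbounded.\<close>

lemma power_curve_dist_known: "\<exists>m. power_curve (rho_dist_known M G) m"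
proof (rule power_curve_of_parametrization[where S = rate and w = "\<lambda>p. ln 2 / rate_slope p"])
  show "rate p \<le> rate q" if "0 \<le> p" "p \<le> q" for p q
    using rate_less[of p q] that by (cases "p = q") auto
  show "continuous_on {0<..} (\<lambda>p. ln 2 / rate_slope p)"
    using rate_slope_pos by (intro continuous_intros rate_slope_cont) force
  show "strict_mono_on {0<..} (\<lambda>p. ln 2 / rate_slope p)"
    using rate_slope_less rate_slope_pos
    by (intro strict_mono_onI divide_strict_left_mono mult_pos_pos) auto
  show "\<exists>p>0. ln 2 / rate_slope p > K" for K
  proof -
    define p where "p = max 0 K / ln 2 + 1"
    have p: "p > 0" by (simp add: p_def add_nonneg_pos)
    have "ln 2 * p = max 0 K + ln 2" by (simp add: p_def algebra_simps)
    moreover have "ln 2 > (0::real)" by simp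
    ultimately have "K < ln 2 * p" by linarith
    also have "\<dots> = ln 2 / (1 / p)" by simp
    also have "\<dots> \<le> ln 2 / rate_slope p"
      using p rate_slope_le[OF p] rate_slope_pos[OF p] by (intro divide_left_mono mult_pos_pos) auto
    finally show ?thesis using p by blast
  qed
  show "rho_dist_known M G 0 = 0" using rho_dist_known_rate[of 0] rate_0 by simp
  show "rho_dist_known M G s \<ge> 0" if "s \<ge> 0" for s
    using rate_surj[OF that] rho_dist_known_rate by metis
  show "rho_dist_known M G (rate p) + ln 2 / rate_slope p * (t - rate p) \<le> rho_dist_known M G t"
    if "p > 0" "t \<ge> 0" for p t
  proof -
    obtain q where q: "q \<ge> 0" "rate q = t" using rate_surj \<open>t \<ge> 0\<close> by blast
    have "ln 2 / rate_slope p * (t - rate p) \<le> ln 2 / rate_slope p * (rate_slope p * (q - p) / ln 2)"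
      using rate_tangent[of p q] q that rate_slope_pos[of p] by (intro mult_left_mono) auto
    also have "\<dots> = q - p" using rate_slope_pos[of p] that by simp
    finally show ?thesis using rho_dist_known_rate[of p] rho_dist_known_rate[of q] q that by simp
  qed
qed (use rate_cont rate_0 rate_less rate_unbounded in auto)

section \<open>Fading channel tracked by the transmitter: water-filling\<close>

definition waterfill :: "real \<Rightarrow> real \<Rightarrow> real" where
  "waterfill \<mu> g = max 0 (\<mu> - 1 / g)" \<comment> \<open>junk value \<open>\<mu>\<close> at \<open>g = 0\<close>, a null event\<close>

abbreviation allocation :: "(real \<Rightarrow> real) \<Rightarrow> bool" where
  "allocation \<equiv> power_allocation M G"

definition mean_power :: "(real \<Rightarrow> real) \<Rightarrow> real" where
  "mean_power p = (\<integral>\<omega>. p (G \<omega>) \<partial>M)"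

definition mean_rate :: "(real \<Rightarrow> real) \<Rightarrow> real" where
  "mean_rate p = (\<integral>\<omega>. log 2 (1 + G \<omega> * p (G \<omega>)) \<partial>M)"

lemma waterfill_gain: "g > 0 \<Longrightarrow> 1 + g * waterfill \<mu> g = max 1 (\<mu> * g)"
proof -
  assume g: "g > 0"
  then have "1 + g * waterfill \<mu> g = 1 + max 0 (g * (\<mu> - 1 / g))"
    by (simp add: waterfill_def max_mult_distrib_left)
  also have "g * (\<mu> - 1 / g) = \<mu> * g - 1" using g by (simp add: field_simps)
  finally show ?thesis by (simp add: max_def)
qed

lemma allocation_waterfill:
  assumes "\<mu> \<ge> 0" shows "allocation (waterfill \<mu>)"
  unfolding power_allocation_def
proof (intro conjI allI impI)
  show "integrable M (\<lambda>\<omega>. waterfill \<mu> (G \<omega>))"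
  proof (rule integrable_const_bound[of _ \<mu>])
    show "AE \<omega> in M. norm (waterfill \<mu> (G \<omega>)) \<le> \<mu>"
      using G_pos by eventually_elim (use assms in \<open>auto simp: waterfill_def\<close>)
  qed (simp add: waterfill_def)
  show "waterfill \<mu> \<in> borel_measurable borel"
    unfolding waterfill_def[abs_def] by measurable
qed (simp add: waterfill_def)

text \<open>The rate is at most \<open>log 2 (1 + g) + p g / ln 2\<close>, and both terms have
  finite mean.\<close>

lemma mean_rate_integrable:
  assumes "allocation p" shows "integrable M (\<lambda>\<omega>. log 2 (1 + G \<omega> * p (G \<omega>)))"
proof (rule Bochner_Integration.integrable_bound)
  have [measurable]: "p \<in> borel_measurable borel" and int: "integrable M (\<lambda>\<omega>. p (G \<omega>))"
    and p: "\<And>g. g \<ge> 0 \<Longrightarrow> p g \<ge> 0"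
    using assms by (auto simp: power_allocation_def)
  show "(\<lambda>\<omega>. log 2 (1 + G \<omega> * p (G \<omega>))) \<in> borel_measurable M" by measurable
  show "integrable M (\<lambda>\<omega>. log 2 (1 + G \<omega>) + p (G \<omega>) / ln 2)"
    using unit_rate_integrable int by simp
  show "AE \<omega> in M. norm (log 2 (1 + G \<omega> * p (G \<omega>))) \<le> norm (log 2 (1 + G \<omega>) + p (G \<omega>) / ln 2)"
    using G_pos
  proof eventually_elim
    case (elim \<omega>)
    have pos: "p (G \<omega>) \<ge> 0" using p elim by simp
    then have b: "0 \<le> log 2 (1 + G \<omega> * p (G \<omega>))"
      "log 2 (1 + G \<omega> * p (G \<omega>)) \<le> log 2 (1 + G \<omega>) + log 2 (1 + p (G \<omega>))"
      using log2_rate_bounds[of "G \<omega>" "p (G \<omega>)"] elim by auto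
    moreover have "log 2 (1 + p (G \<omega>)) \<le> p (G \<omega>) / ln 2"
      using pos by (simp add: log_def divide_right_mono ln_add_one_self_le_self)
    ultimately show ?case unfolding real_norm_def abs_of_nonneg[OF b(1)] by linarith
  qed
qed

text \<open>
  The multiplier inequality of the constrained optimisation problem: the marginal rate
  \<open>g / (1 + g * p)\<close> of the water-filling allocation is at most \<open>1 / \<mu>\<close>, with equality where the
  allocation is positive.
\<close>

lemma waterfill_tangent:
  assumes "\<mu> > 0" "g > 0" "q \<ge> 0"
  shows "log 2 (1 + g * q) \<le> log 2 (1 + g * waterfill \<mu> g) + (q - waterfill \<mu> g) / (\<mu> * ln 2)"
proof -
  let ?y = "max 1 (\<mu> * g)"
  have "1 + g * q > 0" "?y > 0" using assms by (auto simp: add_pos_nonneg)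
  then have "log 2 (1 + g * q) \<le> log 2 ?y + (1 + g * q - ?y) / ?y / ln 2"
    by (rule log2_tangent)
  moreover have "(1 + g * q - ?y) / ?y \<le> (q - waterfill \<mu> g) / \<mu>"
  proof (cases "\<mu> * g \<le> 1")
    case True
    then have "waterfill \<mu> g = 0" using assms by (simp add: waterfill_def field_simps)
    moreover have "g * q \<le> q / \<mu>"
      using True assms mult_right_mono[OF True assms(3)] by (simp add: field_simps)
    ultimately show ?thesis using True by (simp add: max_def)
  next
    case False
    then have "waterfill \<mu> g = \<mu> - 1 / g" using assms by (simp add: waterfill_def field_simps)
    moreover have "(1 + g * q - \<mu> * g) / (\<mu> * g) = (q - (\<mu> - 1 / g)) / \<mu>"
      using assms by (simp add: field_simps)
    ultimately show ?thesis using False by (simp add: max_def)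
  qed
  then have "(1 + g * q - ?y) / ?y / ln 2 \<le> (q - waterfill \<mu> g) / \<mu> / ln 2"
    by (rule divide_right_mono) simp
  ultimately show ?thesis unfolding waterfill_gain[OF assms(2)] by simp
qed

text \<open>Integrating \<open>waterfill_tangent\<close> shows that water-filling maximises the
  Lagrangian \<open>mean_rate p - mean_power p / (\<mu> * ln 2)\<close> over all
  allocations.\<close>

lemma mean_rate_le:
  assumes "\<mu> > 0" "allocation p"
  shows "mean_rate p \<le> mean_rate (waterfill \<mu>) + (mean_power p - mean_power (waterfill \<mu>)) / (\<mu> * ln 2)"
proof -
  have w: "allocation (waterfill \<mu>)" using assms by (intro allocation_waterfill) auto
  have int: "integrable M (\<lambda>\<omega>. p (G \<omega>))" "integrable M (\<lambda>\<omega>. waterfill \<mu> (G \<omega>))"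
    using assms w by (auto simp: power_allocation_def)
  have int': "integrable M (\<lambda>\<omega>. (p (G \<omega>) - waterfill \<mu> (G \<omega>)) / (\<mu> * ln 2))"
    using int by simp
  have "mean_rate p \<le> (\<integral>\<omega>. log 2 (1 + G \<omega> * waterfill \<mu> (G \<omega>)) +
      (p (G \<omega>) - waterfill \<mu> (G \<omega>)) / (\<mu> * ln 2) \<partial>M)"
    unfolding mean_rate_def
  proof (rule integral_mono_AE)
    show "AE \<omega> in M. log 2 (1 + G \<omega> * p (G \<omega>)) \<le> log 2 (1 + G \<omega> * waterfill \<mu> (G \<omega>)) +
      (p (G \<omega>) - waterfill \<mu> (G \<omega>)) / (\<mu> * ln 2)"
      using G_pos
    proof eventually_elim
      case (elim \<omega>)
      then have "p (G \<omega>) \<ge> 0" using assms(2) by (simp add: power_allocation_def)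
      then show ?case using assms(1) elim by (intro waterfill_tangent)
    qed
  qed (intro mean_rate_integrable assms w int' Bochner_Integration.integrable_add)+
  also have "\<dots> = mean_rate (waterfill \<mu>) + (mean_power p - mean_power (waterfill \<mu>)) / (\<mu> * ln 2)"
    unfolding Bochner_Integration.integral_add[OF mean_rate_integrable[OF w] int']
      integral_divide_zero Bochner_Integration.integral_diff[OF int]
    by (simp only: mean_rate_def mean_power_def)
  finally show ?thesis .
qed

lemma mean_power_nonneg:
  assumes "allocation p" shows "mean_power p \<ge> 0"
  unfolding mean_power_def
proof (rule integral_nonneg_AE)
  show "AE \<omega> in M. 0 \<le> p (G \<omega>)"
    using G_pos by eventually_elim (use assms in \<open>simp add: power_allocation_def\<close>)
qed

text \<open>The mean rate of the water-filling allocation without the term \<open>1 / g\<close>; the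
  integrand is continuous in \<open>\<mu> \<ge> 0\<close> and, for positive gain,
  nondecreasing.\<close>

definition waterfill_rate :: "real \<Rightarrow> real" where
  "waterfill_rate \<mu> = (\<integral>\<omega>. log 2 (max 1 (\<mu> * G \<omega>)) \<partial>M)"

lemma mean_rate_waterfill: "mean_rate (waterfill \<mu>) = waterfill_rate \<mu>"
  unfolding mean_rate_def waterfill_rate_def
proof (rule integral_cong_AE)
  show "AE \<omega> in M. log 2 (1 + G \<omega> * waterfill \<mu> (G \<omega>)) = log 2 (max 1 (\<mu> * G \<omega>))"
    using G_pos by eventually_elim (simp add: waterfill_gain)
qed (simp_all add: waterfill_def)

lemma waterfill_rate_0: "waterfill_rate 0 = 0"
  by (simp add: waterfill_rate_def)

lemma log_max_bound:
  fixes x K g :: real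
  assumes "0 \<le> x" "x \<le> K" "g > 0"
  shows "norm (log 2 (max 1 (x * g))) \<le> log 2 (1 + g * K)"
proof -
  have "x * g \<le> g * K" "0 \<le> x * g" using assms by (auto simp: mult.commute)
  then have "max 1 (x * g) \<le> 1 + g * K" by simp
  then have "log 2 (max 1 (x * g)) \<le> log 2 (1 + g * K)" by (intro log_mono) auto
  then show ?thesis by simp
qed

lemma waterfill_rate_integrable:
  assumes "\<mu> \<ge> 0" shows "integrable M (\<lambda>\<omega>. log 2 (max 1 (\<mu> * G \<omega>)))"
proof (rule Bochner_Integration.integrable_bound[OF rate_integrable[OF assms]])
  show "AE \<omega> in M. norm (log 2 (max 1 (\<mu> * G \<omega>))) \<le> norm (log 2 (1 + G \<omega> * \<mu>))"
    using G_pos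
  proof eventually_elim
    case (elim \<omega>)
    show ?case using log_max_bound[OF assms order.refl elim] by (rule order_trans) simp
  qed
qed simp

lemma waterfill_rate_mono:
  assumes "0 \<le> x" "x \<le> y" shows "waterfill_rate x \<le> waterfill_rate y"
  unfolding waterfill_rate_def
proof (rule integral_mono_AE)
  show "AE \<omega> in M. log 2 (max 1 (x * G \<omega>)) \<le> log 2 (max 1 (y * G \<omega>))"
    using G_pos
  proof eventually_elim
    case (elim \<omega>)
    then have "x * G \<omega> \<le> y * G \<omega>" using assms by simp
    then show ?case by (intro log_mono) auto
  qed
qed (use assms waterfill_rate_integrable in auto)

text \<open>Raising the level strictly improves the rate on the event \<open>A\<close> where the
  lower level already transmits. A positive mean rate at \<open>x\<close> forces \<open>A\<close> to
  have positive probability.\<close>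

lemma waterfill_rate_less:
  assumes "0 < x" "x < y" "waterfill_rate x > 0" shows "waterfill_rate x < waterfill_rate y"
proof -
  define A where "A = {\<omega> \<in> space M. 1 < x * G \<omega>}"
  have A: "A \<in> sets M" unfolding A_def by measurable
  have "emeasure M A \<noteq> 0"
  proof
    assume "emeasure M A = 0"
    then have "AE \<omega> in M. \<not> 1 < x * G \<omega>"
      by (intro AE_I[of _ _ A]) (use A in \<open>auto simp: A_def\<close>)
    then have "AE \<omega> in M. log 2 (max 1 (x * G \<omega>)) = 0"
      by eventually_elim (simp add: max_def)
    then have "waterfill_rate x = 0"
      unfolding waterfill_rate_def by (rule integral_eq_zero_AE)
    then show False using assms by simp
  qed
  moreover have "AE \<omega> in M. \<omega> \<in> A \<longrightarrow> log 2 (max 1 (x * G \<omega>)) \<noteq> log 2 (max 1 (y * G \<omega>))"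
    using G_pos
  proof eventually_elim
    case (elim \<omega>)
    have "x * G \<omega> < y * G \<omega>" using elim assms by simp
    then have "log 2 (max 1 (x * G \<omega>)) < log 2 (max 1 (y * G \<omega>))" if "1 < x * G \<omega>"
      using that by (subst log_less_cancel_iff) auto
    then show ?case by (metis (no_types, lifting) A_def less_irrefl mem_Collect_eq)
  qed
  moreover have "AE \<omega> in M. log 2 (max 1 (x * G \<omega>)) \<le> log 2 (max 1 (y * G \<omega>))"
    using G_pos
  proof eventually_elim
    case (elim \<omega>)
    then have "x * G \<omega> \<le> y * G \<omega>" using assms by simp
    then show ?case by (intro log_mono) auto
  qed
  ultimately show ?thesis
    unfolding waterfill_rate_def using assms A
    by (intro integral_less_AE[of _ _ A] waterfill_rate_integrable) auto
qed

lemma waterfill_rate_cont: "continuous_on {0..} waterfill_rate"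
  unfolding waterfill_rate_def[abs_def]
proof (rule continuous_on_integral_of_dominated)
  have "continuous_on {0..} (\<lambda>\<mu>. log 2 (max 1 (\<mu> * g)))" for g :: real
    by (intro continuous_intros) (auto simp: max_def)
  then show "AE \<omega> in M. continuous_on {0..} (\<lambda>\<mu>. log 2 (max 1 (\<mu> * G \<omega>)))" by simp
next
  fix T :: "real set" assume T: "compact T" "T \<noteq> {}" "T \<subseteq> {0..}"
  then obtain K where K: "K \<in> T" "\<And>p. p \<in> T \<Longrightarrow> p \<le> K" using compact_attains_sup by metis
  have "AE \<omega> in M. norm (log 2 (max 1 (\<mu> * G \<omega>))) \<le> log 2 (1 + G \<omega> * K)" if "\<mu> \<in> T" for \<mu>
    using G_pos by eventually_elim (rule log_max_bound; use T K that in auto)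
  then show "\<exists>b. integrable M b \<and> (\<forall>\<mu>\<in>T. AE \<omega> in M. norm (log 2 (max 1 (\<mu> * G \<omega>))) \<le> b \<omega>)"
    using rate_integrable[of K] T K by blast
qed simp

text \<open>Since \<open>max 1 (\<mu> * g) \<ge> (1 + g * \<mu>) / 2\<close>, this rate is at most
  one bit below that of constant power \<open>\<mu>\<close>.\<close>

lemma waterfill_rate_unbounded: "\<exists>\<mu>\<ge>0. waterfill_rate \<mu> > K"
proof -
  obtain \<mu> where \<mu>: "\<mu> \<ge> 0" "rate \<mu> > K + 1" using rate_unbounded by blast
  have "rate \<mu> - 1 = (\<integral>\<omega>. log 2 (1 + G \<omega> * \<mu>) - 1 \<partial>M)"
    unfolding rate_def using rate_integrable[OF \<mu>(1)] by (simp add: prob_space)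
  also have "\<dots> \<le> waterfill_rate \<mu>"
    unfolding waterfill_rate_def
  proof (rule integral_mono_AE)
    show "AE \<omega> in M. log 2 (1 + G \<omega> * \<mu>) - 1 \<le> log 2 (max 1 (\<mu> * G \<omega>))"
      using G_pos
    proof eventually_elim
      case (elim \<omega>)
      then have pos: "1 + G \<omega> * \<mu> > 0" using \<mu> by (simp add: add_pos_nonneg)
      have "log 2 ((1 + G \<omega> * \<mu>) / 2) \<le> log 2 (max 1 (\<mu> * G \<omega>))"
        using pos by (intro log_mono) (auto simp: max_def mult.commute)
      then show ?case using pos by (simp add: log_divide)
    qed
  qed (use \<mu> rate_integrable waterfill_rate_integrable in auto)
  finally show ?thesis using \<mu> by (intro exI[of _ \<mu>]) auto
qed

lemma rho_channel_known_eq: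
  "rho_channel_known M G s = (LEAST q. \<exists>p. allocation p \<and> mean_rate p \<ge> s \<and> q = mean_power p)"
  by (simp add: rho_channel_known_def mean_rate_def mean_power_def)

text \<open>By \<open>mean_rate_le\<close>, an allocation reaching at least the water-filling rate
  spends at least the water-filling power.\<close>

lemma rho_channel_known_waterfill:
  assumes "\<mu> > 0"
  shows "rho_channel_known M G (waterfill_rate \<mu>) = mean_power (waterfill \<mu>)"
  unfolding rho_channel_known_eq
proof (rule Least_equality)
  show "\<exists>p. allocation p \<and> waterfill_rate \<mu> \<le> mean_rate p \<and> mean_power (waterfill \<mu>) = mean_power p"
    using allocation_waterfill[of \<mu>] assms mean_rate_waterfill by (intro exI[of _ "waterfill \<mu>"]) auto
  fix q assume "\<exists>p. allocation p \<and> waterfill_rate \<mu> \<le> mean_rate p \<and> q = mean_power p"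
  then obtain p where p: "allocation p" "waterfill_rate \<mu> \<le> mean_rate p" "q = mean_power p" by blast
  have "0 \<le> (mean_power p - mean_power (waterfill \<mu>)) / (\<mu> * ln 2)"
    using mean_rate_le[OF assms p(1)] p(2) by (simp add: mean_rate_waterfill)
  then show "mean_power (waterfill \<mu>) \<le> q"
    using assms p(3) by (simp add: zero_le_divide_iff mult_le_0_iff)
qed

lemma rho_channel_known_0: "rho_channel_known M G 0 = 0"
  unfolding rho_channel_known_eq
proof (rule Least_equality)
  show "\<exists>p. allocation p \<and> 0 \<le> mean_rate p \<and> 0 = mean_power p"
    by (intro exI[of _ "\<lambda>_. 0"]) (simp add: power_allocation_def mean_rate_def mean_power_def)
qed (use mean_power_nonneg in auto)

text \<open>A suitable water level exists by the intermediate value theorem; rate 0 is served by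
  zero power. The optimal allocation obtained for a rate \<open>t\<close> is what
  \<open>mean_rate_le\<close> is applied to when the supporting lines are proved.\<close>

lemma rho_channel_known_attained:
  assumes "s \<ge> 0"
  obtains p where "allocation p" "mean_rate p = s" "rho_channel_known M G s = mean_power p"
proof (cases "s = 0")
  case True
  show thesis
    by (rule that[of "\<lambda>_. 0"])
      (simp_all add: True rho_channel_known_0 power_allocation_def mean_rate_def mean_power_def)
next
  case False
  obtain y where y: "y \<ge> 0" "waterfill_rate y > s" using waterfill_rate_unbounded by blast
  have "continuous_on {0..y} waterfill_rate" using waterfill_rate_cont by (rule continuous_on_subset) auto
  then obtain \<mu> where \<mu>: "\<mu> \<ge> 0" "waterfill_rate \<mu> = s"
    using IVT'[of waterfill_rate 0 s y] y waterfill_rate_0 assms by force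
  then have "\<mu> > 0" using False waterfill_rate_0 by (cases "\<mu> = 0") auto
  then show thesis
    using that[of "waterfill \<mu>"] \<mu> allocation_waterfill mean_rate_waterfill rho_channel_known_waterfill
    by auto
qed

text \<open>The parameter is the water level \<open>\<mu>\<close>, and the slope
  \<open>\<mu> * ln 2\<close> is the reciprocal of the multiplier in
  \<open>mean_rate_le\<close>.\<close>

lemma power_curve_channel_known: "\<exists>m. power_curve (rho_channel_known M G) m"
proof (rule power_curve_of_parametrization[where S = waterfill_rate and w = "\<lambda>\<mu>. \<mu> * ln 2"])
  show "continuous_on {0<..} (\<lambda>\<mu>. \<mu> * ln 2 :: real)" by (intro continuous_intros)
  show "strict_mono_on {0<..} (\<lambda>\<mu>. \<mu> * ln 2 :: real)" by (intro strict_mono_onI) simp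
  show "\<exists>\<mu>>0. \<mu> * ln 2 > K" for K :: real
  proof (intro exI conjI)
    have "(max 0 K / ln 2 + 1) * ln 2 = max 0 K + ln 2" by (simp add: distrib_right)
    moreover have "ln 2 > (0::real)" by simp
    ultimately show "(max 0 K / ln 2 + 1) * ln 2 > K" by linarith
  qed (simp add: add_nonneg_pos)
  show "rho_channel_known M G s \<ge> 0" if "s \<ge> 0" for s
    by (rule rho_channel_known_attained[OF that]) (simp add: mean_power_nonneg)
  show "rho_channel_known M G (waterfill_rate \<mu>) + \<mu> * ln 2 * (t - waterfill_rate \<mu>) \<le> rho_channel_known M G t"
    if "\<mu> > 0" "t \<ge> 0" for \<mu> t
  proof -
    obtain p where p: "allocation p" "mean_rate p = t" "rho_channel_known M G t = mean_power p"
      by (rule rho_channel_known_attained[OF \<open>t \<ge> 0\<close>])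
    have "\<mu> * ln 2 * (t - waterfill_rate \<mu>) \<le>
        \<mu> * ln 2 * ((mean_power p - mean_power (waterfill \<mu>)) / (\<mu> * ln 2))"
      using mean_rate_le[OF \<open>\<mu> > 0\<close> p(1)] p(2) that
      by (intro mult_left_mono) (auto simp: mean_rate_waterfill)
    also have "\<dots> = mean_power p - mean_power (waterfill \<mu>)" using that by simp
    finally show ?thesis using p(3) rho_channel_known_waterfill[OF \<open>\<mu> > 0\<close>] by simp
  qed
qed (rule waterfill_rate_cont waterfill_rate_0 waterfill_rate_mono waterfill_rate_less
    waterfill_rate_unbounded rho_channel_known_0 | assumption)+

end

section \<open>Reduction of the channel models to power curves\<close>

lemma positive_gain_of_fading_gain:
  assumes "fading_gain M G" shows "positive_gain M G"
proof -
  interpret prob_space M using assms by (simp add: fading_gain_def)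
  obtain f where f: "distributed M lborel G f" using assms by (auto simp: fading_gain_def)
  have [measurable]: "G \<in> borel_measurable M" using distributed_measurable[OF f] by simp
  \<comment> \<open>A law with a density gives no mass to the point 0, so a nonnegative gain is
    almost surely positive.\<close>
  have "AE x in lborel. x \<noteq> (0::real)"
    by (rule AE_lborel_singleton)
  then have "AE x in density lborel f. x \<noteq> 0"
    using distributed_borel_measurable[OF f] by (subst AE_density) auto
  then have "AE x in distr M lborel G. x \<noteq> 0"
    unfolding distributed_distr_eq_density[OF f] .
  then have "AE \<omega> in M. G \<omega> \<noteq> 0" by (subst (asm) AE_distr_iff) auto
  moreover have "AE \<omega> in M. 0 \<le> G \<omega>" using assms by (simp add: fading_gain_def)
  ultimately have "AE \<omega> in M. 0 < G \<omega>" by eventually_elim simp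
  then show ?thesis
    using assms by unfold_locales (simp_all add: fading_gain_def)
qed

lemma power_curve_of_channel_power:
  assumes "channel_power M \<rho>" shows "\<exists>m. power_curve \<rho> m"
proof -
  from assms consider G where "G > 0" "\<rho> = rho_static G"
    | G where "fading_gain M G" "\<rho> = rho_dist_known M G"
    | G where "fading_gain M G" "\<rho> = rho_channel_known M G"
    unfolding channel_power_def by blast
  then show ?thesis
  proof cases
    case 1
    then show ?thesis by (simp add: power_curve_static)
  next
    case 2
    then show ?thesis
      by (simp add: positive_gain.power_curve_dist_known positive_gain_of_fading_gain)
  next
    case 3
    then show ?thesis
      by (simp add: positive_gain.power_curve_channel_known positive_gain_of_fading_gain)
  qed
qed

text \<open>As \<open>\<phi>\<close> is merely convex,
  \<open>\<kappa> * g_fun \<phi> (B * s) = Pc\<close> may hold on a whole interval, so the limit is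
  asserted to be some root. For \<open>\<kappa> = 0\<close> or linear \<open>\<phi>\<close> there is
  no root; in such cases the optimal rate diverges, which corresponds to an infinite
  \<open>s\<^sub>2\<close>. The filter \<open>at_right 0\<close> lets the noise vanish through
  positive values.\<close>

theorem theorem3:
  fixes B \<xi> Pc \<kappa> :: real and \<phi> \<rho> :: "real \<Rightarrow> real" and M :: "'a measure"
  assumes "B > 0" and "\<xi> > 0" and "Pc > 0" and "\<kappa> \<ge> 0"
    and "\<phi> 0 = 0" and "\<phi> differentiable_on {0..}"
    and "strict_mono_on {0..} \<phi>" and "convex_on {0..} \<phi>"
    and "channel_power M \<rho>"
  shows "strict_mono_on {0<..} (opt_energy B \<xi> Pc \<kappa> \<phi> \<rho>) \<and>
         strict_antimono_on {0<..} (opt_rate B \<xi> Pc \<kappa> \<phi> \<rho>) \<and>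
         (opt_rate B \<xi> Pc \<kappa> \<phi> \<rho> \<longlongrightarrow> 0) at_top \<and>
         ((\<exists>s\<ge>0. \<kappa> * g_fun \<phi> (B * s) = Pc) \<longrightarrow>
           (\<exists>s\<^sub>2\<ge>0. \<kappa> * g_fun \<phi> (B * s\<^sub>2) = Pc \<and>
             (opt_rate B \<xi> Pc \<kappa> \<phi> \<rho> \<longlongrightarrow> s\<^sub>2) (at_right 0))) \<and>
         ((\<nexists>s. s \<ge> 0 \<and> \<kappa> * g_fun \<phi> (B * s) = Pc) \<longrightarrow>
           filterlim (opt_rate B \<xi> Pc \<kappa> \<phi> \<rho>) at_top (at_right 0))"
proof -
  obtain m where "power_curve \<rho> m"
    using power_curve_of_channel_power assms(9) by blast
  then interpret energy_tradeoff \<rho> m B \<xi> Pc \<kappa> \<phi>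
    using assms(1-8) by (intro energy_tradeoff.intro energy_tradeoff_axioms.intro)
  show ?thesis
    using opt_energy_strict_mono best_rate_strict_antimono best_rate_tendsto_0
      best_rate_tendsto_balance best_rate_at_top
    unfolding load_def by blast
qed

end
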